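(* Let $\langle P,\leq,{}^\bot,\&\rangle$ be a Sasaki orthoposet, and for $a,b\in P$ let $a\wedge_\& b = (a^\bot \,\&\, b)^\bot \,\&\, b$. Then for all $a,b\in P$, $$ a\,\&\, b = b\wedge_\& (b\wedge_\& a^\bot)^\bot . $$
   Context: A bounded orthoposet $\langle P,\leq,{}^\bot\rangle$ is a partially ordered set with least element $0$ and greatest element $1$ and an orthocomplementation $a\mapsto a^\bot$, i.e. an order-reversing involution ($a\le b\Rightarrow b^\bot\le a^\bot$, $a^{\bot\bot}=a$) such that for every $a$ the meet of $a$ and $a^\bot$ exists and is $0$, and their join exists and is $1$. A Sasaki orthoposet is a tuple $\langle P,\leq,{}^\bot,\&\rangle$ where $\langle P,\leq,{}^\bot\rangle$ is a bounded orthoposet and $\&:P^2\to P$ is a total binary operation such that for all $a,b,c\in P$: (L-Monotony) $a\le b \Rightarrow a\,\&\,c\le b\,\&\,c$; (R-Reduction) $a\,\&\,b\le b$; (Orthomodularity) $a\le b\Rightarrow a=a\,\&\,b$; (Galois) $a\,\&\,b\le c\Rightarrow c^\bot\,\&\,b\le a^\bot$. *)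

theory Defs
  imports Complex_Main "HOL-Library.Lub_Glb"
begin

text \<open>The poset \<open>P\<close> is the whole type. \<open>isGlb UNIV S x\<close> and \<open>isLub UNIV S x\<close> say that the meet
  (join) of \<open>S\<close> exists and is \<open>x\<close>; no lattice structure is assumed.\<close>

locale bounded_orthoposet =
  fixes orth :: "'a :: {order_bot, order_top} \<Rightarrow> 'a"  ("_\<^sup>\<bottom>" [1000] 1000)
  assumes orth_antimono: "a \<le> b \<Longrightarrow> b\<^sup>\<bottom> \<le> a\<^sup>\<bottom>"
    and orth_involutive: "(a\<^sup>\<bottom>)\<^sup>\<bottom> = a"
    and orth_meet: "isGlb UNIV {a, a\<^sup>\<bottom>} bot"
    and orth_join: "isLub UNIV {a, a\<^sup>\<bottom>} top"

locale sasaki_orthoposet = bounded_orthoposet orth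
  for orth :: "'a :: {order_bot, order_top} \<Rightarrow> 'a"  ("_\<^sup>\<bottom>" [1000] 1000) +
  fixes sasaki :: "'a \<Rightarrow> 'a \<Rightarrow> 'a"  (infixl "\<^bold>&" 70)
  assumes L_Monotony: "a \<le> b \<Longrightarrow> a \<^bold>& c \<le> b \<^bold>& c"
    and R_Reduction: "a \<^bold>& b \<le> b"
    and Orthomodularity: "a \<le> b \<Longrightarrow> a = a \<^bold>& b"
    and Galois: "a \<^bold>& b \<le> c \<Longrightarrow> c\<^sup>\<bottom> \<^bold>& b \<le> a\<^sup>\<bottom>"

definition sasaki_meet :: "('a \<Rightarrow> 'a) \<Rightarrow> ('a \<Rightarrow> 'a \<Rightarrow> 'a) \<Rightarrow> 'a \<Rightarrow> 'a \<Rightarrow> 'a" where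
  "sasaki_meet orth sasaki a b = sasaki (orth (sasaki (orth a) b)) b"

end

theory Submission
  imports Defs
begin

text \<open>The operation \<open>sasaki_meet\<close> computes binary meets, so \<open>m = sasaki_meet b (orth a)\<close> is the meet of
  \<open>b\<close> and the orthocomplement of \<open>a\<close>, and the claim says that \<open>a & b\<close> is the meet of \<open>b\<close> and
  \<open>orth m\<close>. It is a lower bound by (Galois). It is the greatest one because any \<open>x\<close> below \<open>b\<close> and
  \<open>orth m\<close> equals \<open>x & b\<close>, hence lies below \<open>orth m & b\<close>, which lies below \<open>a & b\<close> by (Galois) since
  \<open>orth (a & b) & b\<close> is below both \<open>b\<close> and \<open>orth a\<close>.\<close>

context sasaki_orthoposet
begin

text \<open>Orthogonality of \<open>a & b\<close> to \<open>c\<close> is symmetric in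
  \<open>a\<close> and \<open>c\<close>, so \<open>x & b\<close> is self-adjoint in
  \<open>x\<close>.\<close>

lemma Galois_orth: "a \<^bold>& b \<le> c\<^sup>\<bottom> \<Longrightarrow> c \<^bold>& b \<le> a\<^sup>\<bottom>"
  using Galois[of a b "c\<^sup>\<bottom>"] by (simp add: orth_involutive)

lemma orth_sasaki_le: "(a \<^bold>& b)\<^sup>\<bottom> \<^bold>& b \<le> a\<^sup>\<bottom>"
  by (rule Galois) simp

lemma sasaki_meet_le1: "sasaki_meet orth (\<^bold>&) a b \<le> a"
  using orth_sasaki_le[of "a\<^sup>\<bottom>" b] by (simp add: sasaki_meet_def orth_involutive)

lemma sasaki_meet_le2: "sasaki_meet orth (\<^bold>&) a b \<le> b"
  by (simp add: sasaki_meet_def R_Reduction)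

text \<open>As \<open>c = c & b\<close>, (Galois) turns \<open>c \<le> a\<close> into a bound on
  \<open>orth a & b\<close>; taking orthocomplements and applying \<open>& b\<close> recovers
  \<open>c\<close> on the left.\<close>

lemma sasaki_meet_greatest:
  assumes "c \<le> a" and "c \<le> b"
  shows "c \<le> sasaki_meet orth (\<^bold>&) a b"
proof -
  have c: "c \<^bold>& b = c"
    using assms(2) by (rule Orthomodularity[symmetric])
  have "a\<^sup>\<bottom> \<^bold>& b \<le> c\<^sup>\<bottom>"
    using Galois[of c b a] c assms(1) by simp
  then have "c \<le> (a\<^sup>\<bottom> \<^bold>& b)\<^sup>\<bottom>"
    using orth_antimono orth_involutive by metis
  then have "c \<^bold>& b \<le> (a\<^sup>\<bottom> \<^bold>& b)\<^sup>\<bottom> \<^bold>& b"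
    by (rule L_Monotony)
  then show ?thesis
    using c by (simp add: sasaki_meet_def)
qed

lemma sasaki_eq_sasaki_meet:
  "a \<^bold>& b = sasaki_meet orth (\<^bold>&) b ((sasaki_meet orth (\<^bold>&) b (a\<^sup>\<bottom>))\<^sup>\<bottom>)"
proof -
  define m where "m = sasaki_meet orth (\<^bold>&) b (a\<^sup>\<bottom>)"
  have m: "m \<^bold>& b = m"
    unfolding m_def by (rule Orthomodularity[OF sasaki_meet_le1, symmetric])
  \<comment> \<open>Writing \<open>m\<close> as \<open>m & b\<close> puts
    \<open>m \<le> orth a\<close> into the form that \<open>Galois_orth\<close> turns into
    \<open>a & b \<le> orth m\<close>.\<close>
  have "m \<^bold>& b \<le> a\<^sup>\<bottom>"
    unfolding m by (simp add: m_def sasaki_meet_le2)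
  then have lower: "a \<^bold>& b \<le> sasaki_meet orth (\<^bold>&) b (m\<^sup>\<bottom>)"
    by (rule sasaki_meet_greatest[OF R_Reduction Galois_orth])
  have "(a \<^bold>& b)\<^sup>\<bottom> \<^bold>& b \<le> m"
    unfolding m_def by (rule sasaki_meet_greatest[OF R_Reduction orth_sasaki_le])
  then have upper: "m\<^sup>\<bottom> \<^bold>& b \<le> a \<^bold>& b"
    using Galois[of "(a \<^bold>& b)\<^sup>\<bottom>" b m] by (simp add: orth_involutive)
  have "sasaki_meet orth (\<^bold>&) b (m\<^sup>\<bottom>) = sasaki_meet orth (\<^bold>&) b (m\<^sup>\<bottom>) \<^bold>& b"
    by (rule Orthomodularity[OF sasaki_meet_le1])
  also have "\<dots> \<le> m\<^sup>\<bottom> \<^bold>& b"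
    by (rule L_Monotony[OF sasaki_meet_le2])
  also note upper
  finally show ?thesis
    using lower by (simp add: m_def)
qed

end

theorem proposition6:
  fixes orth :: "'a :: {order_bot, order_top} \<Rightarrow> 'a"
    and sasaki :: "'a \<Rightarrow> 'a \<Rightarrow> 'a"
    and a b :: 'a
  assumes "sasaki_orthoposet orth sasaki"
  shows "sasaki a b = sasaki_meet orth sasaki b (orth (sasaki_meet orth sasaki b (orth a)))"
  using assms by (rule sasaki_orthoposet.sasaki_eq_sasaki_meet)

end
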